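(* The synchronization order is a topological property of a presentation. That is: let $M$ and $M'$ be two finite-state presentations having the same underlying labeled directed graph, i.e. the same alphabet $\mathcal{A}$, the same state set $Q$, and, for all $s,s'\in Q$ and $x\in\mathcal{A}$, the transition $s\xrightarrow{x}s'$ has positive probability in $M$ if and only if it has positive probability in $M'$. Then $M$ and $M'$ have the same synchronization order $k_{\mathbf S}\in\{0,1,2,\dots\}\cup\{\infty\}$.
   Context: A (finite-state, recurrent) presentation is an edge-emitting hidden Markov model: a finite state set $Q$, a finite alphabet $\mathcal{A}$, and transition probabilities $T^{(x)}_{ss'}=\Pr(X_t=x,\mathcal{S}_{t+1}=s'\mid\mathcal{S}_t=s)$ with $\sum_{x,s'}T^{(x)}_{ss'}=1$, run from a stationary state distribution that gives positive probability to every state of $Q$. Here $\mathcal{S}_t$ is the internal state at time $t$ and $X_t\in\mathcal{A}$ is the symbol emitted in the transition from $\mathcal{S}_t$ to $\mathcal{S}_{t+1}$. Write $X_{0:\ell}=X_0X_1\cdots X_{\ell-1}$ (empty if $\ell=0$). The synchronization order of the presentation is $k_{\mathbf S}=\min\{\ell\ge 0 : H[\mathcal{S}_\ell\mid X_{0:\ell}]=0\}$, where $H$ is Shannon (conditional) entropy, and $k_{\mathbf S}=\infty$ if no finite $\ell$ satisfies the condition. Equivalently, it is the minimum length for which every positive-probability word determines the internal state. A quantity is called topological if it depends only on the underlying labeled graph of the presentation and not on the values of the transition probabilities. *)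

theory Defs
  imports "HOL-Probability.Probability" "HOL-Library.Extended_Nat"
begin

text \<open>The state set \<open>Q\<close> and the alphabet are the finite types \<open>'q\<close> and \<open>'a\<close>.
  The kernel value \<open>T s\<close> is the joint law of the emitted symbol and the successor state of \<open>s\<close>, so
  that \<open>pmf (T s) (x, s')\<close> is the entry $T^{(x)}_{ss'}$.  The stationary law \<open>\<pi>\<close> is
  part of the presentation, since it need not be unique when the graph is not strongly connected.\<close>

locale presentation =
  fixes T :: "'q::finite \<Rightarrow> ('a::finite \<times> 'q) pmf"
    and \<pi> :: "'q pmf"
  assumes stationary: "bind_pmf \<pi> (\<lambda>s. map_pmf snd (T s)) = \<pi>"
    and full_support: "set_pmf \<pi> = UNIV"

primrec run_pmf :: "('q \<Rightarrow> ('a \<times> 'q) pmf) \<Rightarrow> nat \<Rightarrow> 'q \<Rightarrow> ('a \<times> 'q) list pmf" where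
  "run_pmf T 0 s = return_pmf []"
| "run_pmf T (Suc n) s =
     bind_pmf (T s) (\<lambda>(x, s'). map_pmf (\<lambda>es. (x, s') # es) (run_pmf T n s'))"

text \<open>Law of a path of \<open>n\<close> transitions, i.e. of the pair of \<open>S\<^sub>0\<close> and the list of the
  \<open>(X\<^sub>t, S\<^sub>t\<^sub>+\<^sub>1)\<close> for \<open>t < n\<close>.  The joint law of \<open>S\<^sub>n\<close> and the first \<open>n\<close> symbols is determined by
  it, so the infinite-horizon process is not needed.\<close>

definition path_pmf :: "('q \<Rightarrow> ('a \<times> 'q) pmf) \<Rightarrow> 'q pmf \<Rightarrow> nat \<Rightarrow> ('q \<times> ('a \<times> 'q) list) pmf" where
  "path_pmf T \<pi> n = bind_pmf \<pi> (\<lambda>s. map_pmf (Pair s) (run_pmf T n s))"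

definition state_at :: "nat \<Rightarrow> 'q \<times> ('a \<times> 'q) list \<Rightarrow> 'q" where
  "state_at t \<omega> = (fst \<omega> # map snd (snd \<omega>)) ! t"

definition emitted_word :: "'q \<times> ('a \<times> 'q) list \<Rightarrow> 'a list" where
  "emitted_word \<omega> = map fst (snd \<omega>)"

definition state_uncertainty ::
  "('q \<Rightarrow> ('a \<times> 'q) pmf) \<Rightarrow> 'q pmf \<Rightarrow> nat \<Rightarrow> real" where
  "state_uncertainty T \<pi> l =
     prob_space.conditional_entropy (measure_pmf (path_pmf T \<pi> l)) 2
       (count_space UNIV) (count_space UNIV) (state_at l) emitted_word"

definition synchronization_order :: "('q \<Rightarrow> ('a \<times> 'q) pmf) \<Rightarrow> 'q pmf \<Rightarrow> enat" where
  "synchronization_order T \<pi> =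
     (if \<exists>l. state_uncertainty T \<pi> l = 0
      then enat (LEAST l. state_uncertainty T \<pi> l = 0)
      else \<infinity>)"

end

theory Submission
  imports Defs
begin

text \<open>The conditional entropy of \<open>X\<close> given \<open>Y\<close> vanishes iff \<open>X\<close> is a function of \<open>Y\<close> on the
  support of the underlying finitely supported law.  The support of the law of paths of length \<open>n\<close>
  consists of all paths of length \<open>n\<close> in the labeled graph, because every state has positive
  stationary probability.\<close>

text \<open>Radon-Nikodym derivatives are unique only almost everywhere, but the counting measure
  has no nonempty null set, so here the equality holds at every point.\<close>

lemma RN_deriv_count_space_measure_pmf:
  fixes q :: "'b::countable pmf"
  shows "RN_deriv (count_space UNIV) (measure_pmf q) x = ennreal (pmf q x)"
proof -
  interpret sigma_finite_measure "count_space (UNIV :: 'b set)"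
    by (rule sigma_finite_measure_count_space)
  have "AE x in count_space UNIV. ennreal (pmf q x) = RN_deriv (count_space UNIV) (measure_pmf q) x"
    by (rule RN_deriv_unique) (simp_all add: measure_pmf_eq_density)
  then show ?thesis
    by (simp add: AE_count_space)
qed

lemma conditional_entropy_measure_pmf:
  fixes X :: "'c \<Rightarrow> 'x::countable" and Y :: "'c \<Rightarrow> 'y::countable"
  shows "prob_space.conditional_entropy (measure_pmf p) b (count_space UNIV) (count_space UNIV) X Y =
    - measure_pmf.expectation p (\<lambda>\<omega>. log b (pmf (map_pmf (\<lambda>\<omega>. (X \<omega>, Y \<omega>)) p) (X \<omega>, Y \<omega>) /
        pmf (map_pmf Y p) (Y \<omega>)))"
proof -
  \<comment> \<open>Countability makes the product of the counting measures a counting measure, so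
    the joint density is a probability mass function as well.\<close>
  have pair: "count_space UNIV \<Otimes>\<^sub>M count_space UNIV = count_space (UNIV :: ('x \<times> 'y) set)"
    using pair_measure_countable[of "UNIV :: 'x set" "UNIV :: 'y set"] by simp
  have joint: "distr (measure_pmf p) (count_space UNIV) (\<lambda>\<omega>. (X \<omega>, Y \<omega>)) =
      measure_pmf (map_pmf (\<lambda>\<omega>. (X \<omega>, Y \<omega>)) p)"
    and marginal: "distr (measure_pmf p) (count_space UNIV) Y = measure_pmf (map_pmf Y p)"
    by (simp_all add: map_pmf_rep_eq)
  show ?thesis
    unfolding prob_space.conditional_entropy_def[OF prob_space_measure_pmf] pair joint marginal
      RN_deriv_count_space_measure_pmf
    by (simp add: split_beta)
qed

text \<open>The two masses are probabilities of nested events \<open>?A\<close> and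
  \<open>?B\<close>. They agree iff \<open>?B - ?A\<close> is null, that is, iff it misses the
  support.\<close>

lemma pmf_map_pair_eq_iff:
  assumes "\<omega> \<in> set_pmf p"
  shows "pmf (map_pmf (\<lambda>\<omega>. (X \<omega>, Y \<omega>)) p) (X \<omega>, Y \<omega>) = pmf (map_pmf Y p) (Y \<omega>) \<longleftrightarrow>
    (\<forall>\<omega>'\<in>set_pmf p. Y \<omega>' = Y \<omega> \<longrightarrow> X \<omega>' = X \<omega>)"
proof -
  let ?A = "{\<omega>'. X \<omega>' = X \<omega> \<and> Y \<omega>' = Y \<omega>}" and ?B = "{\<omega>'. Y \<omega>' = Y \<omega>}"
  have "pmf (map_pmf (\<lambda>\<omega>. (X \<omega>, Y \<omega>)) p) (X \<omega>, Y \<omega>) = measure_pmf.prob p ?A"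
    "pmf (map_pmf Y p) (Y \<omega>) = measure_pmf.prob p ?B"
    by (simp_all add: pmf_map vimage_def)
  moreover have "measure_pmf.prob p (?B - ?A) = measure_pmf.prob p ?B - measure_pmf.prob p ?A"
    by (rule measure_pmf.finite_measure_Diff) auto
  moreover have "measure_pmf.prob p (?B - ?A) = 0 \<longleftrightarrow> set_pmf p \<inter> (?B - ?A) = {}"
    by (simp add: measure_pmf_zero_iff)
  ultimately show ?thesis
    by auto
qed

text \<open>The entropy is the mean of \<open>- log b (u \<omega> / v \<omega>)\<close>, where
  \<open>u \<omega> / v \<omega>\<close> is the conditional probability of the observed
  \<open>X\<close>-value given the \<open>Y\<close>-value. This ratio lies in (0,1] on the support,
  so no term is negative and the mean vanishes iff every ratio is 1. Finite support turns the mean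
  into a finite sum.\<close>

lemma conditional_entropy_measure_pmf_eq_0_iff:
  fixes X :: "'c \<Rightarrow> 'x::countable" and Y :: "'c \<Rightarrow> 'y::countable"
  assumes fin: "finite (set_pmf p)" and b: "1 < b"
  shows "prob_space.conditional_entropy (measure_pmf p) b (count_space UNIV) (count_space UNIV) X Y = 0
    \<longleftrightarrow> (\<forall>\<omega>\<in>set_pmf p. \<forall>\<omega>'\<in>set_pmf p. Y \<omega>' = Y \<omega> \<longrightarrow> X \<omega>' = X \<omega>)"
proof -
  define u where "u \<omega> = pmf (map_pmf (\<lambda>\<omega>. (X \<omega>, Y \<omega>)) p) (X \<omega>, Y \<omega>)" for \<omega>
  define v where "v \<omega> = pmf (map_pmf Y p) (Y \<omega>)" for \<omega>
  have uv: "0 < u \<omega>" "u \<omega> \<le> v \<omega>" if "\<omega> \<in> set_pmf p" for \<omega>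
  proof -
    show "0 < u \<omega>"
      using that by (auto simp: u_def pmf_positive_iff)
    show "u \<omega> \<le> v \<omega>"
      unfolding u_def v_def pmf_map by (rule measure_pmf.finite_measure_mono) auto
  qed
  have nonneg: "0 \<le> - log b (u \<omega> / v \<omega>) * pmf p \<omega>" if "\<omega> \<in> set_pmf p" for \<omega>
    using uv[OF that] b by (intro mult_nonneg_nonneg) (auto simp: log_le_zero_cancel_iff divide_le_eq_1)
  \<comment> \<open>On the support the weight \<open>pmf p \<omega>\<close> is nonzero and can be
    cancelled.\<close>
  have zero: "- log b (u \<omega> / v \<omega>) * pmf p \<omega> = 0 \<longleftrightarrow> u \<omega> = v \<omega>" if "\<omega> \<in> set_pmf p" for \<omega>
    using uv[OF that] b that
    by (auto simp: set_pmf_iff log_def ln_div)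
  have "prob_space.conditional_entropy (measure_pmf p) b (count_space UNIV) (count_space UNIV) X Y =
      (\<Sum>\<omega>\<in>set_pmf p. - log b (u \<omega> / v \<omega>) * pmf p \<omega>)"
    unfolding conditional_entropy_measure_pmf u_def v_def
    by (subst integral_measure_pmf_real[OF fin]) (auto simp: sum_negf)
  also have "\<dots> = 0 \<longleftrightarrow> (\<forall>\<omega>\<in>set_pmf p. - log b (u \<omega> / v \<omega>) * pmf p \<omega> = 0)"
    using nonneg by (rule sum_nonneg_eq_0_iff[OF fin])
  also have "\<dots> \<longleftrightarrow> (\<forall>\<omega>\<in>set_pmf p. u \<omega> = v \<omega>)"
    using zero by blast
  also have "\<dots> \<longleftrightarrow> (\<forall>\<omega>\<in>set_pmf p. \<forall>\<omega>'\<in>set_pmf p. Y \<omega>' = Y \<omega> \<longrightarrow> X \<omega>' = X \<omega>)"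
    unfolding u_def v_def by (intro ball_cong refl pmf_map_pair_eq_iff)
  finally show ?thesis .
qed

lemma finite_set_run_pmf:
  fixes T :: "'q::finite \<Rightarrow> ('a::finite \<times> 'q) pmf"
  shows "finite (set_pmf (run_pmf T n s))"
  by (induction n arbitrary: s) (auto simp: split_beta)

lemma finite_set_path_pmf:
  fixes T :: "'q::finite \<Rightarrow> ('a::finite \<times> 'q) pmf"
  shows "finite (set_pmf (path_pmf T \<pi> n))"
  by (simp add: path_pmf_def finite_set_run_pmf)

text \<open>The support of a \<open>bind_pmf\<close> is a union of supports indexed by a support, so
  the recursion never sees the actual probabilities.\<close>

lemma set_run_pmf_cong:
  assumes "\<And>s. set_pmf (T s) = set_pmf (T' s)"
  shows "set_pmf (run_pmf T n s) = set_pmf (run_pmf T' n s)"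
  by (induction n arbitrary: s) (simp_all add: assms split_beta)

lemma set_path_pmf_cong:
  assumes "\<And>s. set_pmf (T s) = set_pmf (T' s)" and "set_pmf \<pi> = set_pmf \<pi>'"
  shows "set_pmf (path_pmf T \<pi> n) = set_pmf (path_pmf T' \<pi>' n)"
  using set_run_pmf_cong[of T T', OF assms(1)] by (simp add: path_pmf_def assms(2))

lemma state_uncertainty_eq_0_iff:
  fixes T :: "'q::finite \<Rightarrow> ('a::finite \<times> 'q) pmf"
  shows "state_uncertainty T \<pi> l = 0 \<longleftrightarrow>
    (\<forall>\<omega>\<in>set_pmf (path_pmf T \<pi> l). \<forall>\<omega>'\<in>set_pmf (path_pmf T \<pi> l).
      emitted_word \<omega>' = emitted_word \<omega> \<longrightarrow> state_at l \<omega>' = state_at l \<omega>)"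
  unfolding state_uncertainty_def
  by (rule conditional_entropy_measure_pmf_eq_0_iff[OF finite_set_path_pmf]) simp

theorem theorem1:
  fixes T T' :: "'q::finite \<Rightarrow> ('a::finite \<times> 'q) pmf"
    and \<pi> \<pi>' :: "'q pmf"
  assumes "presentation T \<pi>"
    and "presentation T' \<pi>'"
    and "\<And>s x s'. pmf (T s) (x, s') > 0 \<longleftrightarrow> pmf (T' s) (x, s') > 0"
  shows "synchronization_order T \<pi> = synchronization_order T' \<pi>'"
proof -
  have "set_pmf (T s) = set_pmf (T' s)" for s
    using assms(3)[of s] by (auto simp: pmf_positive_iff)
  \<comment> \<open>The stationary laws may differ, but both charge every state.\<close>
  moreover have "set_pmf \<pi> = set_pmf \<pi>'"
    using assms(1,2) by (simp add: presentation.full_support)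
  ultimately have "set_pmf (path_pmf T \<pi> l) = set_pmf (path_pmf T' \<pi>' l)" for l
    by (rule set_path_pmf_cong)
  then have "state_uncertainty T \<pi> l = 0 \<longleftrightarrow> state_uncertainty T' \<pi>' l = 0" for l
    by (simp add: state_uncertainty_eq_0_iff)
  \<comment> \<open>The order depends only on the set of lengths with zero uncertainty; this covers
    the infinite case too.\<close>
  then show ?thesis
    by (simp add: synchronization_order_def)
qed

end
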